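(* Let $f:\mathbb{R}^n\to\mathbb{R}$ be an $L$-smooth function satisfying $\arg\min f\neq\emptyset$, and let $h>0$ and $x_k\in\mathbb{R}^n$. If $f$ is convex and $\nabla f(x_k)\neq0$ holds, then there exists a unique nontrivial (i.e. nonzero) solution $\eta_k\in\mathbb{R}$ of the nonlinear equation $F_h(\eta_k;x_k)=0$, and it satisfies $$\left(1+\frac{Lh}{2}\right)^{-1}\le\eta_k\le1.$$
   Context: A function $f$ is $L$-smooth ($L>0$) if it is differentiable and $\nabla f$ is Lipschitz continuous with constant $L$. For $h>0$, $\eta\in\mathbb{R}$ and $x\in\mathbb{R}^n$, define $$F_h(\eta;x)=f(x-\eta h\nabla f(x))-f(x)+h\eta^2\|\nabla f(x)\|^2,$$ where $\|\cdot\|$ is the Euclidean norm. The equation $F_h(\eta;x)=0$ always has the trivial solution $\eta=0$. *)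

theory Defs
  imports "HOL-Analysis.Analysis"
begin

text \<open>The gradient is only meaningful where the function is differentiable;
  elsewhere its value is unspecified.\<close>

definition grad :: "('a::euclidean_space \<Rightarrow> real) \<Rightarrow> 'a \<Rightarrow> 'a" where
  "grad f x = (THE D. GDERIV f x :> D)"

lemma GDERIV_grad:
  fixes f :: "'a::euclidean_space \<Rightarrow> real"
  assumes "f differentiable (at x)"
  shows "GDERIV f x :> grad f x"
proof -
  obtain f' where f': "(f has_derivative f') (at x)"
    using assms unfolding differentiable_def by blast
  then have lin: "linear f'"
    by (rule has_derivative_linear)
  define D where "D = (\<Sum>b\<in>Basis. f' b *\<^sub>R b)"
  have "f' v = v \<bullet> D" for v
  proof -
    have "f' v = f' (\<Sum>b\<in>Basis. (v \<bullet> b) *\<^sub>R b)"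
      by (simp add: euclidean_representation)
    also have "\<dots> = (\<Sum>b\<in>Basis. (v \<bullet> b) * f' b)"
      by (simp add: linear_sum[OF lin] linear_cmul[OF lin])
    also have "\<dots> = v \<bullet> D"
      by (simp add: D_def inner_sum_right mult.commute)
    finally show ?thesis .
  qed
  then have "f' = (\<lambda>v. v \<bullet> D)"
    by (rule ext)
  with f' have ex: "GDERIV f x :> D"
    by (simp add: gderiv_def)
  have uniq: "E = D" if "GDERIV f x :> E" for E
  proof -
    have "(\<lambda>h. h \<bullet> E) = (\<lambda>h. h \<bullet> D)"
      using that ex unfolding gderiv_def by (rule has_derivative_unique)
    then show ?thesis
      using vector_eq_ldot[of E D] by (simp add: fun_eq_iff)
  qed
  show ?thesis
    unfolding grad_def using ex uniq by (rule theI)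
qed

definition L_smooth :: "real \<Rightarrow> ('a::euclidean_space \<Rightarrow> real) \<Rightarrow> bool" where
  "L_smooth L f \<longleftrightarrow>
     L > 0 \<and> (\<forall>x. f differentiable (at x)) \<and> L-lipschitz_on UNIV (grad f)"

definition F :: "('a::euclidean_space \<Rightarrow> real) \<Rightarrow> real \<Rightarrow> real \<Rightarrow> 'a \<Rightarrow> real" where
  "F f h \<eta> x = f (x - (\<eta> * h) *\<^sub>R grad f x) - f x + h * \<eta>\<^sup>2 * (norm (grad f x))\<^sup>2"

end

theory Submission
  imports Defs
begin

text \<open>Tangent-line convexity gives \<open>F f h \<eta> x \<ge> h * (\<eta>\<^sup>2 - \<eta>) * (norm (grad f x))\<^sup>2\<close>, and the descent
  lemma gives the matching upper bound with \<open>\<eta>\<^sup>2\<close> replaced by \<open>(1 + L * h / 2) * \<eta>\<^sup>2\<close>. The first is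
  nonnegative outside \<open>(0, 1)\<close>, the second nonpositive at \<open>inverse (1 + L * h / 2)\<close>; hence the bounds on
  every nonzero root, and existence by the intermediate value theorem. Uniqueness holds because
  \<open>\<eta> \<mapsto> F f h \<eta> x\<close> is strictly convex and vanishes at \<open>0\<close>.\<close>

text \<open>Chain rule shared by the tangent inequality and the descent lemma, both of which
  restrict \<open>f\<close> to a line.\<close>

lemma has_real_derivative_along_line:
  fixes f :: "'a::euclidean_space \<Rightarrow> real"
  assumes "f differentiable (at (x + t *\<^sub>R d))"
  shows "((\<lambda>t. f (x + t *\<^sub>R d)) has_real_derivative d \<bullet> grad f (x + t *\<^sub>R d)) (at t)"
proof -
  have "(f has_derivative (\<lambda>v. v \<bullet> grad f (x + t *\<^sub>R d))) (at (x + t *\<^sub>R d))"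
    using GDERIV_grad[OF assms] by (simp add: gderiv_def)
  moreover have "((\<lambda>t. x + t *\<^sub>R d) has_derivative (\<lambda>s. s *\<^sub>R d)) (at t)"
    by (auto intro!: derivative_eq_intros)
  ultimately have "((\<lambda>t. f (x + t *\<^sub>R d)) has_derivative
      (\<lambda>s. (s *\<^sub>R d) \<bullet> grad f (x + t *\<^sub>R d))) (at t)"
    by (rule has_derivative_compose[rotated])
  then show ?thesis
    by (simp add: has_field_derivative_def mult.commute[of _ "d \<bullet> _"])
qed

text \<open>Along the line \<open>t \<mapsto> x + t *\<^sub>R d\<close> the function stays convex,
  so the one-dimensional tangent at \<open>0\<close>, evaluated at \<open>1\<close>,
  suffices.\<close>

lemma convex_above_tangent:
  fixes f :: "'a::euclidean_space \<Rightarrow> real"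
  assumes cvx: "convex_on UNIV f" and diff: "f differentiable (at x)"
  shows "f x + d \<bullet> grad f x \<le> f (x + d)"
proof -
  let ?u = "\<lambda>t. f (x + t *\<^sub>R d)"
  have "convex_on UNIV ?u"
  proof (intro convex_onI)
    fix t a b :: real
    assume "0 < t" "t < 1"
    moreover have "x + ((1 - t) *\<^sub>R a + t *\<^sub>R b) *\<^sub>R d
        = (1 - t) *\<^sub>R (x + a *\<^sub>R d) + t *\<^sub>R (x + b *\<^sub>R d)"
      by (simp add: algebra_simps)
    ultimately show "?u ((1 - t) *\<^sub>R a + t *\<^sub>R b) \<le> (1 - t) * ?u a + t * ?u b"
      using convex_onD[OF cvx, of t "x + a *\<^sub>R d" "x + b *\<^sub>R d"] by simp
  qed simp
  moreover have "(?u has_real_derivative d \<bullet> grad f x) (at 0)"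
    using has_real_derivative_along_line[of f x 0 d] diff by simp
  ultimately have "(d \<bullet> grad f x) * (1 - 0) \<le> ?u 1 - ?u 0"
    by (intro convex_on_imp_above_tangent[where A = UNIV]) auto
  then show ?thesis by simp
qed

lemma descent_lemma:
  fixes f :: "'a::euclidean_space \<Rightarrow> real"
  assumes "L_smooth L f"
  shows "f (x + d) \<le> f x + d \<bullet> grad f x + L / 2 * (norm d)\<^sup>2"
proof -
  have diff: "f differentiable (at y)" for y
    using assms by (simp add: L_smooth_def)
  have lip: "L-lipschitz_on UNIV (grad f)"
    using assms by (simp add: L_smooth_def)
  \<comment> \<open>The gap between \<open>f\<close> and the claimed bound along the segment.
    Showing that it does not increase on [0, 1] replaces integrating the gradient.\<close>
  let ?u = "\<lambda>t. f (x + t *\<^sub>R d) - t * (d \<bullet> grad f x) - L / 2 * t\<^sup>2 * (norm d)\<^sup>2"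
  have "?u 1 \<le> ?u 0"
  proof (rule DERIV_nonpos_imp_nonincreasing[of 0 1 ?u])
    fix t :: real
    assume "0 \<le> t"
    let ?D = "d \<bullet> grad f (x + t *\<^sub>R d) - d \<bullet> grad f x - L * t * (norm d)\<^sup>2"
    have "(?u has_real_derivative ?D) (at t)"
      by (auto intro!: derivative_eq_intros has_real_derivative_along_line diff)
    moreover have "?D \<le> 0"
    proof -
      have "d \<bullet> grad f (x + t *\<^sub>R d) - d \<bullet> grad f x
          \<le> norm d * norm (grad f (x + t *\<^sub>R d) - grad f x)"
        by (metis inner_diff_right norm_cauchy_schwarz)
      also have "\<dots> \<le> norm d * (L * (t * norm d))"
        using lipschitz_onD[OF lip, of "x + t *\<^sub>R d" x] \<open>0 \<le> t\<close>
        by (intro mult_left_mono) (auto simp: dist_norm)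
      finally show ?thesis by (simp add: power2_eq_square algebra_simps)
    qed
    ultimately show "\<exists>D. (?u has_real_derivative D) (at t) \<and> D \<le> 0" by blast
  qed simp
  then show ?thesis by simp
qed

lemma F_lower_bound:
  fixes f :: "'a::euclidean_space \<Rightarrow> real"
  assumes "convex_on UNIV f" "f differentiable (at x)"
  shows "h * (norm (grad f x))\<^sup>2 * (\<eta>\<^sup>2 - \<eta>) \<le> F f h \<eta> x"
  using convex_above_tangent[OF assms, of "- ((\<eta> * h) *\<^sub>R grad f x)"]
  by (simp add: F_def dot_square_norm algebra_simps)

lemma F_upper_bound:
  fixes f :: "'a::euclidean_space \<Rightarrow> real"
  assumes "L_smooth L f"
  shows "F f h \<eta> x \<le> h * (norm (grad f x))\<^sup>2 * ((1 + L * h / 2) * \<eta>\<^sup>2 - \<eta>)"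
  using descent_lemma[OF assms, of x "- ((\<eta> * h) *\<^sub>R grad f x)"]
  by (simp add: F_def dot_square_norm power_mult_distrib algebra_simps power2_eq_square[of h])

text \<open>Strict convexity made explicit: at the smaller root, convexity puts \<open>f\<close>
  below its chord from \<open>x\<close> to the point of the larger root, which forces
  \<open>a * b \<le> a * a\<close>.\<close>

lemma F_pos_roots_not_less:
  fixes f :: "'a::euclidean_space \<Rightarrow> real"
  assumes cvx: "convex_on UNIV f" and "h > 0" "grad f x \<noteq> 0"
    and "0 < a" "a < b" and roots: "F f h a x = 0" "F f h b x = 0"
  shows False
proof -
  let ?p = "\<lambda>\<eta>. x - (\<eta> * h) *\<^sub>R grad f x" and ?c = "h * (norm (grad f x))\<^sup>2"
  have c: "?c > 0" using assms by simp
  \<comment> \<open>The weight \<open>a / b\<close> writes \<open>a\<close> as a convex combination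
    of \<open>0\<close> and \<open>b\<close>.\<close>
  have "(1 - a / b) *\<^sub>R x + (a / b) *\<^sub>R ?p b = ?p a"
    using assms by (simp add: algebra_simps)
  then have "f (?p a) \<le> (1 - a / b) * f x + (a / b) * f (?p b)"
    using convex_onD[OF cvx, of "a / b" x "?p b"] assms by simp
  \<comment> \<open>At a root the equation can be solved for the value of \<open>f\<close>.\<close>
  moreover have "f (?p a) = f x - ?c * a\<^sup>2" "f (?p b) = f x - ?c * b\<^sup>2"
    using roots by (simp_all add: F_def algebra_simps)
  ultimately have "f x - ?c * a\<^sup>2 \<le> (1 - a / b) * f x + (a / b) * (f x - ?c * b\<^sup>2)"
    by simp
  also have "\<dots> = f x - ?c * (a * b)"
    using assms by (simp add: field_simps power2_eq_square)
  finally have "?c * (a * b) \<le> ?c * (a * a)" by (simp add: power2_eq_square)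
  then have "b \<le> a"
    using c \<open>0 < a\<close> by (simp only: mult_le_cancel_left_pos)
  with \<open>a < b\<close> show False by simp
qed

theorem theorem3p7:
  fixes f :: "real ^ 'n \<Rightarrow> real" and L h :: real and x\<^sub>k :: "real ^ 'n"
  assumes "L_smooth L f"
    and "{x. is_arg_min f (\<lambda>_. True) x} \<noteq> {}"
    and "h > 0"
    and "convex_on UNIV f"
    and "grad f x\<^sub>k \<noteq> 0"
  shows "(\<exists>!\<eta>. \<eta> \<noteq> 0 \<and> F f h \<eta> x\<^sub>k = 0) \<and>
         (\<forall>\<eta>. \<eta> \<noteq> 0 \<and> F f h \<eta> x\<^sub>k = 0 \<longrightarrow>
            inverse (1 + L * h / 2) \<le> \<eta> \<and> \<eta> \<le> 1)"
proof -
  define q where "q = 1 + L * h / 2"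
  define c where "c = h * (norm (grad f x\<^sub>k))\<^sup>2"
  have diff: "f differentiable (at y)" for y
    using assms(1) by (simp add: L_smooth_def)
  have q: "q > 1" using assms(1,3) by (simp add: q_def L_smooth_def)
  have c: "c > 0" using assms(3,5) by (simp add: c_def)
  have lower: "c * (\<eta>\<^sup>2 - \<eta>) \<le> F f h \<eta> x\<^sub>k" for \<eta>
    unfolding c_def by (rule F_lower_bound[OF assms(4) diff])
  have upper: "F f h \<eta> x\<^sub>k \<le> c * (q * \<eta>\<^sup>2 - \<eta>)" for \<eta>
    unfolding c_def q_def by (rule F_upper_bound[OF assms(1)])
  have bounds: "inverse q \<le> \<eta> \<and> \<eta> \<le> 1" if "\<eta> \<noteq> 0" "F f h \<eta> x\<^sub>k = 0" for \<eta>
  proof -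
    \<comment> \<open>Since \<open>\<eta>\<close> is at least its own square, a nonzero root is
      positive; only then may \<open>\<eta>\<close> be cancelled from both inequalities.\<close>
    have "\<eta> * \<eta> \<le> \<eta> * 1"
      using lower[of \<eta>] that c by (simp add: mult_le_0_iff power2_eq_square)
    moreover from this have "\<eta> > 0"
      using \<open>\<eta> \<noteq> 0\<close> zero_le_square[of \<eta>] by linarith
    moreover have "\<eta> * 1 \<le> \<eta> * (q * \<eta>)"
      using upper[of \<eta>] that c by (simp add: zero_le_mult_iff power2_eq_square mult.left_commute)
    ultimately have "\<eta> \<le> 1" "1 \<le> q * \<eta>"
      by (simp_all only: mult_le_cancel_left_pos)
    then show ?thesis
      using q by (simp add: field_simps)
  qed
  \<comment> \<open>The upper bound vanishes at \<open>inverse q\<close> and the lower bound at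
    \<open>1\<close>. Starting at \<open>inverse q\<close> instead of \<open>0\<close> keeps the
    trivial root out.\<close>
  have "\<exists>\<eta>\<ge>inverse q. \<eta> \<le> 1 \<and> F f h \<eta> x\<^sub>k = 0"
  proof (rule IVT')
    show "F f h (inverse q) x\<^sub>k \<le> 0"
      using upper[of "inverse q"] q by (simp add: power2_eq_square field_simps)
    show "0 \<le> F f h 1 x\<^sub>k"
      using lower[of 1] by simp
    show "inverse q \<le> 1"
      using q by (simp add: field_simps)
    have "continuous_on UNIV f"
      using diff by (simp add: continuous_on_eq_continuous_at differentiable_imp_continuous_within)
    then have "continuous_on {inverse q..1} (\<lambda>\<eta>. f (x\<^sub>k - (\<eta> * h) *\<^sub>R grad f x\<^sub>k))"
      by (rule continuous_on_compose2) (auto intro!: continuous_intros)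
    then show "continuous_on {inverse q..1} (\<lambda>\<eta>. F f h \<eta> x\<^sub>k)"
      unfolding F_def by (intro continuous_intros)
  qed
  then obtain \<eta> where \<eta>: "inverse q \<le> \<eta>" "F f h \<eta> x\<^sub>k = 0" by blast
  have pos: "a > 0" if "inverse q \<le> a" for a
    using that q by (meson inverse_positive_iff_positive less_le_trans less_trans zero_less_one)
  have "\<exists>!\<eta>. \<eta> \<noteq> 0 \<and> F f h \<eta> x\<^sub>k = 0"
  proof (intro ex1I)
    show "\<eta> \<noteq> 0 \<and> F f h \<eta> x\<^sub>k = 0"
      using \<eta> pos by fastforce
    fix a
    assume a: "a \<noteq> 0 \<and> F f h a x\<^sub>k = 0"
    then have "a > 0" using bounds pos by blast
    then show "a = \<eta>"
      \<comment> \<open>Both roots are positive, so the lemma excludes either strict order.\<close>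
      using F_pos_roots_not_less[OF assms(4,3,5)] a \<eta> pos[OF \<eta>(1)]
      by (metis linorder_neqE_linordered_idom)
  qed
  then show ?thesis
    using bounds unfolding q_def by blast
qed

end
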